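(* If $d>0$, $\nu>0$, $k\in\mathbb{R}$, $\alpha,\beta,\gamma\in\mathbb{C}$ with $\Re(\alpha)>0$, $\Re(\beta)>0$, $\Re(\gamma)>0$, and $\tau\in(0,1)\cup\mathbb{N}$, then the solution of the equation $$N(t)-N_{0}\,E^{\gamma,\tau}_{k,\alpha,\beta}(t)=-d^{\nu}\,{}_{0}D^{-\nu}_{t}N(t)$$ is given by $$N(t)=N_{0}\sum_{n=0}^{\infty}\frac{(\gamma)_{n\tau,k}}{\Gamma_k(n\alpha+\beta)}\,t^n\,E_{\nu,n+1}(-d^{\nu}t^{\nu}).$$
   Context: Here $N(t)$ is the unknown function (the number density of a species at time $t$) and $N_0$ is a constant (the number density at time $t=0$). The $k$-gamma function is $\Gamma_k(x)=k^{\frac{x}{k}-1}\Gamma\left(\frac{x}{k}\right)$, and the $k$-Pochhammer symbol is $(\gamma)_{nq,k}=k^{nq}\left(\frac{\gamma}{k}\right)_{nq}$, where $(x)_{nq}=\frac{\Gamma(x+nq)}{\Gamma(x)}$. The generalized $k$-Mittag-Leffler function is $$E^{\gamma,q}_{k,\alpha,\beta}(z)=\sum_{n=0}^\infty\frac{(\gamma)_{nq,k}\,z^n}{\Gamma_k(n\alpha+\beta)\,n!}.$$ The two-index Mittag-Leffler function is $E_{\mu,\lambda}(x)=\sum_{r=0}^{\infty}\frac{x^{r}}{\Gamma(\mu r+\lambda)}$. The Riemann-Liouville fractional integral operator is $${}_{0}D^{-\nu}_{t}f(t)=\frac{1}{\Gamma(\nu)}\int_{0}^{t}(t-s)^{\nu-1}f(s)\,ds\qquad(t>0,\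 \Re(\nu)>0).$$
   Formalization: The equation is considered only at t>0 inside the open disc of convergence of the series E^{γ,τ}_{k,α,β}(t), since for some admitted parameters (e.g. k=α=β=γ=1, τ=3) that series diverges for every t>0; if it converges everywhere, all t>0 are covered. *)

theory Defs
  imports "HOL-Analysis.Analysis"
begin

text \<open>Powers with complex exponent are principal values, also for a negative base \<open>k\<close>.\<close>

definition k_Gamma :: "real \<Rightarrow> complex \<Rightarrow> complex" where
  "k_Gamma k x = of_real k powr (x / of_real k - 1) * Gamma (x / of_real k)"

text \<open>
  The index is a real number \<open>p\<close> (of the form \<open>n * q\<close>), so the library's
  \<open>pochhammer\<close>, whose index is a natural number, does not apply.
\<close>

definition gen_pochhammer :: "complex \<Rightarrow> real \<Rightarrow> complex" where
  "gen_pochhammer x p = Gamma (x + of_real p) / Gamma x"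

definition k_pochhammer :: "real \<Rightarrow> complex \<Rightarrow> real \<Rightarrow> complex" where
  "k_pochhammer k \<gamma> p = of_real k powr of_real p * gen_pochhammer (\<gamma> / of_real k) p"

definition k_Mittag_Leffler ::
    "real \<Rightarrow> complex \<Rightarrow> complex \<Rightarrow> complex \<Rightarrow> real \<Rightarrow> complex \<Rightarrow> complex" where
  "k_Mittag_Leffler k \<alpha> \<beta> \<gamma> q z =
     (\<Sum>n. k_pochhammer k \<gamma> (real n * q) * z ^ n / (k_Gamma k (of_nat n * \<alpha> + \<beta>) * fact n))"

text \<open>
  The power series above is entire for some parameters, but for others (large \<open>q\<close>) its
  radius of convergence is finite or even 0.  The following set consists of the positive
  times inside the open disc of convergence; it is all of \<open>{0<..}\<close> if the series is entire.
\<close>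

definition k_Mittag_Leffler_times ::
    "real \<Rightarrow> complex \<Rightarrow> complex \<Rightarrow> complex \<Rightarrow> real \<Rightarrow> real set" where
  "k_Mittag_Leffler_times k \<alpha> \<beta> \<gamma> q =
     {t. 0 < t \<and> ereal t < conv_radius
       (\<lambda>n. k_pochhammer k \<gamma> (real n * q) / (k_Gamma k (of_nat n * \<alpha> + \<beta>) * fact n))}"

definition Mittag_Leffler :: "complex \<Rightarrow> complex \<Rightarrow> complex \<Rightarrow> complex" where
  "Mittag_Leffler \<mu> \<rho> x = (\<Sum>r. x ^ r / Gamma (\<mu> * of_nat r + \<rho>))"

text \<open>
  The Riemann-Liouville integral of order \<open>\<nu>\<close>.  As \<open>integral\<close> is 0 on non-integrable
  functions, existence of the integral in the sense of Lebesgue is a separate predicate.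
\<close>

definition RL_integrable :: "complex \<Rightarrow> (real \<Rightarrow> complex) \<Rightarrow> real \<Rightarrow> bool" where
  "RL_integrable \<nu> f t \<longleftrightarrow>
     (\<lambda>s. of_real (t - s) powr (\<nu> - 1) * f s) absolutely_integrable_on {0..t}"

definition RL_integral :: "complex \<Rightarrow> (real \<Rightarrow> complex) \<Rightarrow> real \<Rightarrow> complex" where
  "RL_integral \<nu> f t =
     1 / Gamma \<nu> * integral {0..t} (\<lambda>s. of_real (t - s) powr (\<nu> - 1) * f s)"

text \<open>
  A solution of the equation on a set \<open>T\<close> of times: the fractional integral has to exist at
  every time of \<open>T\<close>, and no other regularity is imposed on \<open>N\<close>.
\<close>

definition kinetic_solution_on ::
    "real set \<Rightarrow> real \<Rightarrow> real \<Rightarrow> complex \<Rightarrow> (real \<Rightarrow> complex) \<Rightarrow> (real \<Rightarrow> complex) \<Rightarrow> bool" where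
  "kinetic_solution_on T d \<nu> N0 f N \<longleftrightarrow>
     (\<forall>t\<in>T. RL_integrable (of_real \<nu>) N t \<and>
        N t - N0 * f t = - of_real (d powr \<nu>) * RL_integral (of_real \<nu>) N t)"

end

theory Submission
  imports Defs
begin

text \<open>
  Only the coefficients \<open>a n\<close> of the series matter: the equation has the same form for any
  forcing term \<open>\<Sum>n. a n * t ^ n / fact n\<close> inside its disc of convergence, and \<open>c = d powr \<nu>\<close>
  is any positive number.

  Existence: the fractional integral of order \<open>\<nu>\<close> sends \<open>t powr p / Gamma (p + 1)\<close> to
  \<open>t powr (\<nu> + p) / Gamma (\<nu> + p + 1)\<close>.  So, with \<open>E n\<close> for the Mittag-Leffler function with
  indices \<open>\<nu>\<close> and \<open>n + 1\<close>, applying \<open>- c\<close> times it to \<open>t ^ n * E n (- c * t powr \<nu>)\<close> shifts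
  the series of \<open>E n\<close> by one and removes its leading term \<open>t ^ n / fact n\<close>.  Both termwise
  integrations are dominated, since \<open>fact n * Gamma (x + 1) \<le> Gamma (x + n + 1)\<close> bounds \<open>E n\<close>
  by \<open>E 0 / fact n\<close>.

  Uniqueness: the difference \<open>W\<close> of two solutions satisfies \<open>W = - c * RL_integral \<nu> W\<close>.  In
  the norm \<open>\<integral> exp (- l * t) * \<bar>W t\<bar> dt\<close> Tonelli's theorem bounds the right-hand side by
  \<open>c / l powr \<nu>\<close> times the norm of \<open>W\<close>, so for large \<open>l\<close> the function \<open>W\<close> vanishes almost
  everywhere, hence by the equation everywhere.
\<close>

subsection \<open>Bounds for Mittag-Leffler series\<close>

text \<open>Keep only the part of Euler's integral over \<open>{A..}\<close>: there
  \<open>t powr y\<close> is at least \<open>A powr y\<close>, and the exponential integrates to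
  \<open>exp (- A)\<close>. As \<open>A\<close> is free, Gamma outgrows every geometric sequence,
  with no appeal to Stirling.\<close>

lemma Gamma_ge_powr_exp:
  fixes A y :: real
  assumes "A > 0" "y \<ge> 0"
  shows "A powr y * exp (- A) \<le> Gamma (y + 1)"
proof -
  have "((\<lambda>x::real. A powr y * exp (- 1 * x)) has_integral A powr y * (exp (- 1 * A) / 1)) {A..}"
    by (intro has_integral_mult_right has_integral_exp_minus_to_infinity) simp
  hence "((\<lambda>x. if x \<in> {A..} then A powr y * exp (- x) else 0) has_integral A powr y * exp (- A)) {0..}"
    using assms by (subst has_integral_restrict) auto
  moreover have "((\<lambda>t. t powr (y + 1 - 1) / exp t) has_integral Gamma (y + 1)) {0..}"
    by (rule Gamma_integral_real) (use assms in simp)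
  ultimately show ?thesis
    by (rule has_integral_le) (use assms in \<open>auto simp: exp_minus field_simps intro!: powr_mono2\<close>)
qed

lemma summable_power_over_Gamma:
  fixes \<nu> x :: real
  assumes "\<nu> > 0" "x \<ge> 0"
  shows "summable (\<lambda>r. x ^ r / Gamma (\<nu> * real r + 1))"
proof -
  \<comment> \<open>With this choice \<open>A powr (\<nu> * r)\<close> is
    \<open>(2 * x + 1) ^ r\<close>, so the terms are dominated by a geometric series of ratio
    \<open>x / (2 * x + 1) < 1\<close>.\<close>
  define A where "A = (2 * x + 1) powr (1 / \<nu>)"
  have A: "A > 0" "A powr \<nu> = 2 * x + 1"
    using assms by (auto simp: A_def powr_powr)
  have le: "x ^ r / Gamma (\<nu> * real r + 1) \<le> exp A * (x / (2 * x + 1)) ^ r" for r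
  proof -
    have "(2 * x + 1) ^ r * exp (- A) \<le> Gamma (\<nu> * real r + 1)"
      using Gamma_ge_powr_exp[of A "\<nu> * real r"] A assms
      by (simp flip: powr_powr add: powr_realpow)
    hence "x ^ r / Gamma (\<nu> * real r + 1) \<le> x ^ r / ((2 * x + 1) ^ r * exp (- A))"
      using assms by (intro divide_left_mono) (auto intro!: mult_pos_pos Gamma_real_pos add_nonneg_pos)
    thus ?thesis by (simp add: exp_minus field_simps)
  qed
  show ?thesis
  proof (rule summable_comparison_test')
    show "summable (\<lambda>r. exp A * (x / (2 * x + 1)) ^ r)"
      using assms by (intro summable_mult summable_geometric) (auto simp: field_simps)
    show "norm (x ^ r / Gamma (\<nu> * real r + 1)) \<le> exp A * (x / (2 * x + 1)) ^ r" for r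
      using le[of r] assms Gamma_real_pos[of "\<nu> * real r + 1"]
      by (simp add: add_nonneg_pos)
  qed
qed

text \<open>By the functional equation a step in \<open>n\<close> multiplies the right side by
  \<open>x + n + 1\<close>, the left side only by \<open>n + 1\<close>.\<close>

lemma fact_Gamma_le_Gamma_add:
  fixes x :: real
  assumes "x \<ge> 0"
  shows "fact n * Gamma (x + 1) \<le> Gamma (x + (real n + 1))"
proof (induction n)
  case (Suc n)
  have pos: "Gamma (x + (real n + 1)) > 0"
    using assms by (intro Gamma_real_pos) auto
  have "fact (Suc n) * Gamma (x + 1) = (real n + 1) * (fact n * Gamma (x + 1))"
    by simp
  also have "\<dots> \<le> (x + (real n + 1)) * Gamma (x + (real n + 1))"
    using Suc assms pos by (intro mult_mono) (auto intro!: mult_nonneg_nonneg Gamma_real_nonneg)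
  also have "\<dots> = Gamma (x + (real n + 1) + 1)"
    by (rule Gamma_plus1 [symmetric]) (use assms in \<open>auto elim!: nonpos_Ints_cases\<close>)
  also have "x + (real n + 1) + 1 = x + (real (Suc n) + 1)"
    by simp
  finally show ?case .
qed simp

text \<open>The substitution \<open>s = t * u\<close> leads to the Beta integral with parameters
  \<open>p + 1\<close> and \<open>\<nu>\<close>.\<close>

lemma has_integral_Abel_kernel_powr:
  fixes \<nu> p t :: real
  assumes "\<nu> > 0" "p > -1" "t > 0"
  shows "((\<lambda>s. (t - s) powr (\<nu> - 1) * s powr p) has_integral
           (Gamma \<nu> * Gamma (p + 1) / Gamma (\<nu> + p + 1) * t powr (\<nu> + p))) {0..t}"
proof -
  have "((\<lambda>s. s powr (p + 1 - 1) * (1 - s) powr (\<nu> - 1)) has_integral Beta (p + 1) \<nu>) {0..1}"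
    by (rule has_integral_Beta_real) (use assms in auto)
  hence "((\<lambda>s. (1 / t * s) powr p * (1 - 1 / t * s) powr (\<nu> - 1)) has_integral
          (1 / \<bar>1 / t\<bar>) *\<^sub>R Beta (p + 1) \<nu>) ((\<lambda>x. x / (1 / t)) ` {0..1})"
    using assms by (intro has_integral_stretch_real) auto
  also have "(\<lambda>x. x / (1 / t)) ` {0..1} = {0..t}"
    using assms by (auto simp: image_def field_simps intro!: bexI[of _ "_ / t"])
  \<comment> \<open>Exponents of \<open>t\<close>: the kernel gives \<open>\<nu> - 1\<close>, the
    power gives \<open>p\<close>, and the substitution adds one more.\<close>
  finally have "((\<lambda>s. t powr (\<nu> + p - 1) * ((1 / t * s) powr p * (1 - 1 / t * s) powr (\<nu> - 1))) has_integral
          t powr (\<nu> + p - 1) * (t * Beta (p + 1) \<nu>)) {0..t}"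
    using assms by (intro has_integral_mult_right) simp
  also have "t powr (\<nu> + p - 1) * (t * Beta (p + 1) \<nu>) =
               Gamma \<nu> * Gamma (p + 1) / Gamma (\<nu> + p + 1) * t powr (\<nu> + p)"
    using assms by (simp add: Beta_def powr_diff add_ac)
  finally show ?thesis
  proof (rule has_integral_eq[rotated])
    fix s assume s: "s \<in> {0..t}"
    have eq: "1 - 1 / t * s = (t - s) / t" using assms by (simp add: field_simps)
    show "t powr (\<nu> + p - 1) * ((1 / t * s) powr p * (1 - 1 / t * s) powr (\<nu> - 1)) =
          (t - s) powr (\<nu> - 1) * s powr p"
      unfolding eq using s assms
      by (simp add: powr_divide powr_add powr_diff)
  qed
qed

text \<open>Real values keep the signs and the order needed for domination;
  \<open>Mittag_Leffler_of_real\<close> leads back to the complex function.\<close>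

definition Mittag_Leffler_real :: "real \<Rightarrow> nat \<Rightarrow> real \<Rightarrow> real" where
  "Mittag_Leffler_real \<nu> n x = (\<Sum>r. x ^ r / Gamma (\<nu> * real r + (real n + 1)))"

context
  fixes \<nu> :: real
  assumes \<nu>: "\<nu> > 0"
begin

lemma Mittag_Leffler_term_le:
  "\<bar>x\<bar> ^ r / Gamma (\<nu> * real r + (real n + 1)) \<le> \<bar>x\<bar> ^ r / Gamma (\<nu> * real r + 1) / fact n"
proof -
  have pos: "Gamma (\<nu> * real r + 1) > 0"
    using \<nu> by (intro Gamma_real_pos add_nonneg_pos) auto
  have "\<bar>x\<bar> ^ r / Gamma (\<nu> * real r + (real n + 1)) \<le> \<bar>x\<bar> ^ r / (fact n * Gamma (\<nu> * real r + 1))"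
    using \<nu> pos by (intro divide_left_mono fact_Gamma_le_Gamma_add mult_pos_pos Gamma_real_pos)
       (auto intro!: add_nonneg_pos)
  thus ?thesis by (simp add: field_simps)
qed

lemma Gamma_Mittag_Leffler_pos: "Gamma (\<nu> * real r + (real n + 1)) > 0"
  using \<nu> by (intro Gamma_real_pos add_nonneg_pos) auto

lemma summable_Mittag_Leffler_abs: "summable (\<lambda>r. \<bar>x ^ r / Gamma (\<nu> * real r + (real n + 1))\<bar>)"
proof (rule summable_comparison_test')
  show "summable (\<lambda>r. \<bar>x\<bar> ^ r / Gamma (\<nu> * real r + 1) / fact n)"
    using \<nu> by (intro summable_divide summable_power_over_Gamma) auto
  show "norm \<bar>x ^ r / Gamma (\<nu> * real r + (real n + 1))\<bar> \<le> \<bar>x\<bar> ^ r / Gamma (\<nu> * real r + 1) / fact n" for r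
    using Mittag_Leffler_term_le[of x r n] Gamma_Mittag_Leffler_pos[of r n] by (simp add: power_abs)
qed

lemmas summable_Mittag_Leffler = summable_rabs_cancel[OF summable_Mittag_Leffler_abs]

lemma abs_Mittag_Leffler_real_le:
  assumes "\<bar>x\<bar> \<le> y"
  shows "\<bar>Mittag_Leffler_real \<nu> n x\<bar> \<le> Mittag_Leffler_real \<nu> 0 y / fact n"
proof -
  have "\<bar>Mittag_Leffler_real \<nu> n x\<bar> \<le> (\<Sum>r. \<bar>x ^ r / Gamma (\<nu> * real r + (real n + 1))\<bar>)"
    unfolding Mittag_Leffler_real_def by (rule summable_rabs[OF summable_Mittag_Leffler_abs])
  also have "\<dots> \<le> (\<Sum>r. y ^ r / Gamma (\<nu> * real r + (real 0 + 1)) / fact n)"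
  proof (intro suminf_le summable_Mittag_Leffler_abs summable_divide summable_Mittag_Leffler)
    fix r
    have "\<bar>x ^ r / Gamma (\<nu> * real r + (real n + 1))\<bar> \<le> \<bar>x\<bar> ^ r / Gamma (\<nu> * real r + 1) / fact n"
      using Mittag_Leffler_term_le[of x r n] Gamma_Mittag_Leffler_pos[of r n] by (simp add: power_abs)
    also have "\<dots> \<le> y ^ r / Gamma (\<nu> * real r + (real 0 + 1)) / fact n"
      using Gamma_Mittag_Leffler_pos[of r 0] power_mono[OF assms, of r]
      by (intro divide_right_mono) (auto intro!: divide_right_mono)
    finally show "\<bar>x ^ r / Gamma (\<nu> * real r + (real n + 1))\<bar> \<le> \<dots>" .
  qed
  also have "\<dots> = Mittag_Leffler_real \<nu> 0 y / fact n"
    unfolding Mittag_Leffler_real_def by (intro suminf_divide summable_Mittag_Leffler)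
  finally show ?thesis .
qed

lemma Mittag_Leffler_of_real:
  "Mittag_Leffler (of_real \<nu>) (of_nat n + 1) (of_real x) = of_real (Mittag_Leffler_real \<nu> n x)"
proof -
  have "Mittag_Leffler (of_real \<nu>) (of_nat n + 1) (of_real x) =
          (\<Sum>r. complex_of_real (x ^ r / Gamma (\<nu> * real r + (real n + 1))))"
    unfolding Mittag_Leffler_def by (simp flip: Gamma_complex_of_real)
  thus ?thesis
    unfolding Mittag_Leffler_real_def by (simp add: suminf_of_real[OF summable_Mittag_Leffler])
qed

end

subsection \<open>Fractional integrals of Mittag-Leffler series\<close>

text \<open>This is the series theorem of the Bochner integral for functions cut off by the
  indicator of \<open>S\<close>, carried over to the gauge integral \<open>integral\<close>. The two
  integrals agree because all functions involved are absolutely integrable.\<close>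

lemma
  fixes f :: "nat \<Rightarrow> 'a::euclidean_space \<Rightarrow> 'b::euclidean_space"
  assumes "\<And>n. f n absolutely_integrable_on S"
    and "\<And>x. x \<in> S \<Longrightarrow> summable (\<lambda>n. norm (f n x))"
    and "summable (\<lambda>n. integral S (\<lambda>x. norm (f n x)))"
  shows absolutely_integrable_on_suminf: "(\<lambda>x. \<Sum>n. f n x) absolutely_integrable_on S" (is ?A)
    and sums_integral_termwise: "(\<lambda>n. integral S (f n)) sums integral S (\<lambda>x. \<Sum>n. f n x)" (is ?B)
proof -
  let ?g = "\<lambda>n x. indicator S x *\<^sub>R f n x"
  have int: "integrable lebesgue (?g n)" for n
    using assms(1) by (simp add: set_integrable_def)
  have summ: "AE x in lebesgue. summable (\<lambda>n. norm (?g n x))"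
    using assms(2) by (auto simp: indicator_def)
  have "integral\<^sup>L lebesgue (\<lambda>x. norm (?g n x)) = integral S (\<lambda>x. norm (f n x))" for n
    using set_lebesgue_integral_eq_integral(2)[OF absolutely_integrable_norm[OF assms(1)[of n]]]
    by (simp add: set_lebesgue_integral_def o_def)
  hence sums: "summable (\<lambda>n. integral\<^sup>L lebesgue (\<lambda>x. norm (?g n x)))"
    using assms(3) by simp
  have eq: "(\<lambda>x. \<Sum>n. ?g n x) = (\<lambda>x. indicator S x *\<^sub>R (\<Sum>n. f n x))"
    by (auto simp: indicator_def)
  show A: ?A
    using integrable_suminf[OF int summ sums] unfolding set_integrable_def eq .
  have eq': "integral\<^sup>L lebesgue (?g n) = integral S (f n)" for n
    using set_lebesgue_integral_eq_integral(2)[OF assms(1)[of n]]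
    by (simp add: set_lebesgue_integral_def)
  show ?B
    using sums_integral[OF int summ sums] set_lebesgue_integral_eq_integral(2)[OF A]
    unfolding eq eq' by (simp add: set_lebesgue_integral_def)
qed

lemma Abel_kernel_Mittag_Leffler_real:
  fixes \<nu> c t :: real and n :: nat
  assumes "\<nu> > 0" "c > 0" "t > 0"
  defines "h \<equiv> (\<lambda>s. (t - s) powr (\<nu> - 1) * (s ^ n * Mittag_Leffler_real \<nu> n (- (c * s powr \<nu>))))"
  shows "h absolutely_integrable_on {0..t}"
    and "integral {0..t} h =
           Gamma \<nu> / c * (t ^ n / fact n - t ^ n * Mittag_Leffler_real \<nu> n (- (c * t powr \<nu>)))"
proof -
  let ?G = "\<lambda>r. Gamma (\<nu> * real r + (real n + 1))"
  let ?k = "\<lambda>r s. (t - s) powr (\<nu> - 1) * s powr (\<nu> * real r + real n)"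
  \<comment> \<open>The summand \<open>r = 0, n = 0\<close> is wrong at \<open>s = 0\<close>, where \<open>0 powr 0 = 0\<close> but \<open>0 ^ 0 = 1\<close>;
    hence the null set \<open>{0}\<close> below.\<close>
  define f where "f = (\<lambda>r s. (- c) ^ r / ?G r * ?k r s)"
  \<comment> \<open>\<open>q r\<close> is the Mittag-Leffler term at the endpoint \<open>t\<close>;
    integrating \<open>f r\<close> yields a multiple of \<open>q (Suc r)\<close>, which is the
    shift.\<close>
  define q where "q = (\<lambda>r. (- (c * t powr \<nu>)) ^ r / ?G r)"
  have G: "?G r > 0" for r
    by (rule Gamma_Mittag_Leffler_pos) fact
  have k: "(?k r has_integral Gamma \<nu> * ?G r / ?G (Suc r) * t powr (\<nu> * real (Suc r) + real n)) {0..t}" for r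
    using has_integral_Abel_kernel_powr[of \<nu> "\<nu> * real r + real n" t] assms
    by (simp add: algebra_simps add_pos_nonneg less_le_trans[of "-1" 0])
  have kt: "t powr (\<nu> * real r + real n) = t ^ n * (t powr \<nu>) ^ r" if "t > 0" for r and t :: real
    using that by (simp add: powr_add powr_realpow flip: powr_powr)
  have f_int: "(f r has_integral - (Gamma \<nu> * t ^ n / c * q (Suc r))) {0..t}" for r
  proof -
    have "(f r has_integral (- c) ^ r / ?G r * (Gamma \<nu> * ?G r / ?G (Suc r) * t powr (\<nu> * real (Suc r) + real n))) {0..t}"
      unfolding f_def by (intro has_integral_mult_right k)
    moreover have "(- c) ^ r / ?G r * (Gamma \<nu> * ?G r / ?G (Suc r) * t powr (\<nu> * real (Suc r) + real n))
       = - (Gamma \<nu> * t ^ n / c * q (Suc r))"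
      using G[of r] assms
      by (subst kt) (auto simp: q_def power_mult_distrib power_minus[of "c * _"] power_minus[of c])
    ultimately show ?thesis by metis
  qed
  \<comment> \<open>All factors except \<open>(- c) ^ r\<close> are nonnegative, so the sign depends
    on \<open>r\<close> alone and the integral of the norm follows from the signed one.\<close>
  have norm_f: "norm (f r s) = (-1) ^ r * f r s" for r s
    using G[of r] assms by (simp add: f_def abs_mult power_abs power_minus[of c])
  have norm_f_int: "((\<lambda>s. norm (f r s)) has_integral Gamma \<nu> * t ^ n / c * \<bar>q (Suc r)\<bar>) {0..t}" for r
  proof -
    have "((\<lambda>s. norm (f r s)) has_integral (-1) ^ r * (- (Gamma \<nu> * t ^ n / c * q (Suc r)))) {0..t}"
      unfolding norm_f by (intro has_integral_mult_right f_int)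
    moreover have "(-1) ^ r * (- (Gamma \<nu> * t ^ n / c * q (Suc r))) = Gamma \<nu> * t ^ n / c * \<bar>q (Suc r)\<bar>"
      using G[of "Suc r"] \<open>c > 0\<close>
      by (cases "even r") (simp_all add: q_def abs_mult uminus_power_if abs_of_pos del: power_Suc)
    ultimately show ?thesis by metis
  qed
  have f_eq: "f r s = (t - s) powr (\<nu> - 1) * (s ^ n * ((- (c * s powr \<nu>)) ^ r / ?G r))"
    if "s > 0" for r s
    using that by (simp add: f_def kt power_mult_distrib power_minus[of "c * _"] power_minus[of c])
  have q: "summable (\<lambda>r. \<bar>q r\<bar>)"
    unfolding q_def by (rule summable_Mittag_Leffler_abs) fact
  have f_ai: "f r absolutely_integrable_on {0..t}" for r
    unfolding absolutely_integrable_on_def using f_int norm_f_int by blast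
  have summ: "summable (\<lambda>r. norm (f r s))" if "s \<in> {0..t}" for s
  proof (cases "s = 0")
    case True
    thus ?thesis by (simp add: f_def)
  next
    case False
    hence "norm (f r s) = \<bar>(t - s) powr (\<nu> - 1) * s ^ n\<bar> * \<bar>(- (c * s powr \<nu>)) ^ r / ?G r\<bar>" for r
      using that by (subst f_eq) (auto simp: abs_mult)
    thus ?thesis
      using summable_mult[OF summable_Mittag_Leffler_abs[OF \<open>\<nu> > 0\<close>]] by simp
  qed
  \<comment> \<open>Up to a constant factor these integrals are the tail of the absolutely
    convergent series of \<open>q\<close>.\<close>
  have "summable (\<lambda>r. integral {0..t} (\<lambda>s. norm (f r s)))"
    unfolding integral_unique[OF norm_f_int]
    using q by (intro summable_mult) (subst summable_Suc_iff)
  note termwise = absolutely_integrable_on_suminf[OF f_ai summ this]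
    sums_integral_termwise[OF f_ai summ this]
  have h: "(\<Sum>r. f r s) = h s" if "s \<in> {0..t} - {0}" for s
  proof -
    have "(\<Sum>r. f r s) = (\<Sum>r. (t - s) powr (\<nu> - 1) * s ^ n * ((- (c * s powr \<nu>)) ^ r / ?G r))"
      using that f_eq by (intro suminf_cong) (simp add: mult_ac)
    also have "\<dots> = h s"
      unfolding h_def Mittag_Leffler_real_def mult.assoc[symmetric]
      by (intro suminf_mult summable_Mittag_Leffler) fact
    finally show ?thesis .
  qed
  show "h absolutely_integrable_on {0..t}"
    using termwise(1) by (rule absolutely_integrable_spike[where S = "{0}"]) (use h in auto)
  have "integral {0..t} h = integral {0..t} (\<lambda>s. \<Sum>r. f r s)"
    by (rule integral_spike[where S = "{0}"]) (use h in auto)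
  also have "\<dots> = (\<Sum>r. - (Gamma \<nu> * t ^ n / c) * q (Suc r))"
    using termwise(2) by (simp add: integral_unique[OF f_int] sums_iff)
  also have "\<dots> = - (Gamma \<nu> * t ^ n / c) * (\<Sum>r. q (Suc r))"
    using summable_rabs_cancel[OF q] by (intro suminf_mult) (subst summable_Suc_iff)
  \<comment> \<open>The lost head is \<open>q 0 = 1 / Gamma (n + 1)\<close>; it becomes the summand
    of the forcing term.\<close>
  also have "(\<Sum>r. q (Suc r)) = Mittag_Leffler_real \<nu> n (- (c * t powr \<nu>)) - 1 / fact n"
    using suminf_split_head[OF summable_rabs_cancel[OF q]] Gamma_fact[of n, where 'a = real]
    by (simp add: Mittag_Leffler_real_def q_def add_ac)
  finally show "integral {0..t} h =
      Gamma \<nu> / c * (t ^ n / fact n - t ^ n * Mittag_Leffler_real \<nu> n (- (c * t powr \<nu>)))"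
    by (simp add: algebra_simps)
qed

text \<open>\<open>a n\<close> leaves out the \<open>1 / fact n\<close> of the forcing term: that
  factor reappears as the constant term of the Mittag-Leffler function with second index
  \<open>n + 1\<close>.\<close>

definition kinetic_series :: "(nat \<Rightarrow> complex) \<Rightarrow> real \<Rightarrow> real \<Rightarrow> real \<Rightarrow> complex" where
  "kinetic_series a \<nu> c t =
     (\<Sum>n. a n * of_real t ^ n * Mittag_Leffler (of_real \<nu>) (of_nat n + 1) (- of_real (c * t powr \<nu>)))"

section \<open>Convergence and fractional integral of the solution series\<close>

context
  fixes a :: "nat \<Rightarrow> complex" and \<nu> c t :: real
  assumes \<nu>: "\<nu> > 0" and c: "c > 0" and t: "t > 0"
    and summ: "summable (\<lambda>n. norm (a n) * t ^ n / fact n)"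
begin

lemma Mittag_Leffler_uminus_of_real:
  "Mittag_Leffler (of_real \<nu>) (of_nat n + 1) (- of_real (c * s powr \<nu>)) =
     of_real (Mittag_Leffler_real \<nu> n (- (c * s powr \<nu>)))"
  using Mittag_Leffler_of_real[OF \<nu>, of n "- (c * s powr \<nu>)"] by simp

text \<open>A Weierstrass majorant independent of \<open>s\<close>: convergence at the single time
  \<open>t\<close>, as given by \<open>summ\<close>, controls the whole interval
  \<open>{0..t}\<close>.\<close>

lemma norm_kinetic_series_term_le:
  assumes "s \<in> {0..t}"
  shows "norm (a n * of_real s ^ n * Mittag_Leffler (of_real \<nu>) (of_nat n + 1) (- of_real (c * s powr \<nu>)))
           \<le> Mittag_Leffler_real \<nu> 0 (c * t powr \<nu>) * (norm (a n) * t ^ n / fact n)"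
proof -
  have "\<bar>- (c * s powr \<nu>)\<bar> \<le> c * t powr \<nu>"
    using assms c \<nu> by (auto intro!: powr_mono2)
  from abs_Mittag_Leffler_real_le[OF \<nu> this, of n]
  have "norm (a n) * s ^ n * \<bar>Mittag_Leffler_real \<nu> n (- (c * s powr \<nu>))\<bar> \<le>
          norm (a n) * t ^ n * (Mittag_Leffler_real \<nu> 0 (c * t powr \<nu>) / fact n)"
    using assms by (intro mult_mono power_mono) auto
  thus ?thesis
    unfolding Mittag_Leffler_uminus_of_real using assms by (simp add: norm_mult norm_power mult_ac)
qed

lemma summable_kinetic_series_norm:
  assumes "s \<in> {0..t}"
  shows "summable (\<lambda>n. norm (a n * of_real s ^ n *
           Mittag_Leffler (of_real \<nu>) (of_nat n + 1) (- of_real (c * s powr \<nu>))))"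
  using norm_kinetic_series_term_le[OF assms]
  by (intro summable_comparison_test'[OF summable_mult[OF summ]]) auto

text \<open>The second claim is the equation for \<open>N0 = 1\<close>, solved for the fractional
  integral. Each summand contributes a factor \<open>Gamma \<nu> / c\<close>, whose Gamma cancels
  against the normalisation of \<open>RL_integral\<close>.\<close>

lemma RL_kinetic_series:
  shows "RL_integrable (of_real \<nu>) (kinetic_series a \<nu> c) t" (is ?A)
    and "RL_integral (of_real \<nu>) (kinetic_series a \<nu> c) t =
           ((\<Sum>n. a n * of_real t ^ n / fact n) - kinetic_series a \<nu> c t) / of_real c" (is ?B)
proof -
  let ?K = "\<lambda>s. complex_of_real (t - s) powr (of_real \<nu> - 1)"
  let ?e = "\<lambda>n s. a n * of_real s ^ n * Mittag_Leffler (of_real \<nu>) (of_nat n + 1) (- of_real (c * s powr \<nu>))"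
  let ?M = "Mittag_Leffler_real \<nu> 0 (c * t powr \<nu>)"
  let ?h = "\<lambda>n s. (t - s) powr (\<nu> - 1) * (s ^ n * Mittag_Leffler_real \<nu> n (- (c * s powr \<nu>)))"
  \<comment> \<open>The base is real and nonnegative here, so the principal power is the real one;
    at \<open>s = t\<close> both are 0.\<close>
  have K: "?K s = of_real ((t - s) powr (\<nu> - 1))" if "s \<in> {0..t}" for s
    using that powr_of_real[of "t - s" "\<nu> - 1"] by simp
  \<comment> \<open>This is the Beta integral with \<open>p = 0\<close>; as
    \<open>0 powr 0 = 0\<close>, its integrand differs from the bare kernel at
    \<open>s = 0\<close>.\<close>
  have Kint: "(\<lambda>s. (t - s) powr (\<nu> - 1)) integrable_on {0..t}"
    using has_integral_integrable[OF has_integral_Abel_kernel_powr[OF \<nu> _ t, of 0]]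
    by (rule integrable_spike[where S = "{0}"]) auto
  have eq: "?K s * ?e n s = a n * of_real (?h n s)" if "s \<in> {0..t}" for n s
    unfolding K[OF that] Mittag_Leffler_uminus_of_real by simp
  have h_ai: "(\<lambda>s. a n * of_real (?h n s)) absolutely_integrable_on {0..t}" for n
  proof -
    have "bounded_linear (\<lambda>x. a n * complex_of_real x)"
      by (intro bounded_linear_const_mult bounded_linear_of_real)
    from absolutely_integrable_linear[OF Abel_kernel_Mittag_Leffler_real(1)[OF \<nu> c t, of n] this]
    show ?thesis by (simp add: o_def)
  qed
  have ai: "(\<lambda>s. ?K s * ?e n s) absolutely_integrable_on {0..t}" for n
    using h_ai[of n]
    by (rule absolutely_integrable_spike[where S = "{}"]) (simp_all only: eq negligible_empty Diff_empty)
  have int: "integral {0..t} (\<lambda>s. ?K s * ?e n s) =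
      of_real (Gamma \<nu> / c) * (a n * of_real t ^ n / fact n - ?e n t)" for n
  proof -
    have "integral {0..t} (\<lambda>s. ?K s * ?e n s) = integral {0..t} (\<lambda>s. a n * of_real (?h n s))"
      by (rule integral_cong) (use eq in auto)
    also have "((\<lambda>s. of_real (?h n s) :: complex) has_integral of_real (integral {0..t} (?h n))) {0..t}"
      using Abel_kernel_Mittag_Leffler_real(1)[OF \<nu> c t, of n]
      by (intro has_integral_of_real) (auto simp: absolutely_integrable_on_def)
    hence "integral {0..t} (\<lambda>s. a n * of_real (?h n s)) = a n * of_real (integral {0..t} (?h n))"
      by (intro integral_unique has_integral_mult_right)
    also have "\<dots> = of_real (Gamma \<nu> / c) * (a n * of_real t ^ n / fact n - ?e n t)"
      unfolding Abel_kernel_Mittag_Leffler_real(2)[OF \<nu> c t] Mittag_Leffler_uminus_of_real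
      by (simp add: algebra_simps)
    finally show ?thesis .
  qed
  have bound: "norm (?K s * ?e n s) \<le> (?M * (norm (a n) * t ^ n / fact n)) * (t - s) powr (\<nu> - 1)"
    if "s \<in> {0..t}" for n s
    using mult_left_mono[OF norm_kinetic_series_term_le[OF that, of n], of "(t - s) powr (\<nu> - 1)"]
    unfolding K[OF that] norm_mult by (simp add: mult_ac)
  have summ1: "summable (\<lambda>n. norm (?K s * ?e n s))" if "s \<in> {0..t}" for s
    unfolding norm_mult[of "?K s"] using summable_kinetic_series_norm[OF that] by (rule summable_mult)
  \<comment> \<open>The integral of the kernel is a constant, so integrating the majorant reduces
    summability in \<open>n\<close> to \<open>summ\<close>.\<close>
  have le: "integral {0..t} (\<lambda>s. norm (?K s * ?e n s)) \<le>
        integral {0..t} (\<lambda>s. (t - s) powr (\<nu> - 1)) * ?M * (norm (a n) * t ^ n / fact n)" for n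
  proof -
    have "integral {0..t} (\<lambda>s. norm (?K s * ?e n s)) \<le>
        integral {0..t} (\<lambda>s. (?M * (norm (a n) * t ^ n / fact n)) * (t - s) powr (\<nu> - 1))"
      using ai[of n] by (intro integral_le bound integrable_on_mult_right Kint)
        (auto simp: absolutely_integrable_on_def)
    thus ?thesis by (simp add: mult_ac)
  qed
  have summ2: "summable (\<lambda>n. integral {0..t} (\<lambda>s. norm (?K s * ?e n s)))"
  proof (rule summable_comparison_test'[OF summable_mult[OF summ]])
    fix n :: nat
    have "integral {0..t} (\<lambda>s. norm (?K s * ?e n s)) \<ge> 0"
      using ai[of n] by (intro integral_nonneg) (auto simp: absolutely_integrable_on_def)
    thus "norm (integral {0..t} (\<lambda>s. norm (?K s * ?e n s))) \<le>
        integral {0..t} (\<lambda>s. (t - s) powr (\<nu> - 1)) * ?M * (norm (a n) * t ^ n / fact n)"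
      unfolding real_norm_def by (subst abs_of_nonneg) (use le[of n] in simp_all)
  qed
  have suminf_eq: "(\<Sum>n. ?K s * ?e n s) = ?K s * kinetic_series a \<nu> c s" if "s \<in> {0..t}" for s
    unfolding kinetic_series_def
    by (intro suminf_mult summable_norm_cancel[OF summable_kinetic_series_norm[OF that]])
  show ?A
    unfolding RL_integrable_def using absolutely_integrable_on_suminf[OF ai summ1 summ2]
    by (rule absolutely_integrable_spike[where S = "{}"]) (use suminf_eq in auto)
  have s1: "(\<lambda>n. a n * of_real t ^ n / fact n) sums (\<Sum>n. a n * of_real t ^ n / fact n)"
    by (rule summable_sums, rule summable_norm_cancel)
      (use summ t in \<open>simp add: norm_mult norm_divide norm_power\<close>)
  have s2: "(\<lambda>n. ?e n t) sums kinetic_series a \<nu> c t"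
    unfolding kinetic_series_def using t
    by (intro summable_sums summable_norm_cancel[OF summable_kinetic_series_norm]) auto
  have "integral {0..t} (\<lambda>s. ?K s * kinetic_series a \<nu> c s) = integral {0..t} (\<lambda>s. \<Sum>n. ?K s * ?e n s)"
    by (rule integral_cong) (use suminf_eq in auto)
  also have "\<dots> = of_real (Gamma \<nu> / c) * ((\<Sum>n. a n * of_real t ^ n / fact n) - kinetic_series a \<nu> c t)"
    using sums_integral_termwise[OF ai summ1 summ2] sums_mult[OF sums_diff[OF s1 s2]]
    unfolding int by (rule sums_unique2)
  finally show ?B
    using Gamma_real_pos[OF \<nu>] by (simp add: RL_integral_def Gamma_complex_of_real)
qed

end

subsection \<open>The homogeneous equation\<close>

text \<open>Euler's integral rescaled by \<open>l\<close>, stated for the extended nonnegative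
  integral so that Tonelli's theorem needs no integrability.\<close>

lemma nn_integral_Laplace_powr:
  fixes \<nu> l :: real
  assumes "\<nu> > 0" "l > 0"
  shows "(\<integral>\<^sup>+ u. ennreal (exp (- l * u) * u powr (\<nu> - 1)) * indicator {0<..} u \<partial>lborel)
           = ennreal (Gamma \<nu> / l powr \<nu>)"
proof -
  let ?f = "\<lambda>u::real. ennreal (indicator {0..} u * u powr (\<nu> - 1) / exp u)"
  have "ennreal (Gamma \<nu>) = (\<integral>\<^sup>+ u. ?f u \<partial>lborel)"
    using assms by (subst Gamma_conv_nn_integral_real) auto
  also have "\<dots> = ennreal l * (\<integral>\<^sup>+ u. ?f (0 + l * u) \<partial>lborel)"
    using assms by (subst nn_integral_real_affine[where c = l and t = 0]) auto
  also have "(\<lambda>u. ?f (0 + l * u)) = (\<lambda>u. ennreal (l powr (\<nu> - 1)) *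
               (ennreal (exp (- l * u) * u powr (\<nu> - 1)) * indicator {0<..} u))"
    using assms by (intro ext) (auto simp: indicator_def powr_mult zero_le_mult_iff exp_minus
        field_simps simp flip: ennreal_mult')
  also have "(\<integral>\<^sup>+ u. ennreal (l powr (\<nu> - 1)) *
               (ennreal (exp (- l * u) * u powr (\<nu> - 1)) * indicator {0<..} u) \<partial>lborel) =
             ennreal (l powr (\<nu> - 1)) *
               (\<integral>\<^sup>+ u. ennreal (exp (- l * u) * u powr (\<nu> - 1)) * indicator {0<..} u \<partial>lborel)"
    by (rule nn_integral_cmult) simp
  \<comment> \<open>The Jacobian \<open>l\<close> and the factor \<open>l powr (\<nu> - 1)\<close>
    combine to \<open>l powr \<nu>\<close>.\<close>
  finally have eq: "ennreal (Gamma \<nu>) = ennreal (l powr \<nu>) *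
      (\<integral>\<^sup>+ u. ennreal (exp (- l * u) * u powr (\<nu> - 1)) * indicator {0<..} u \<partial>lborel)"
    using assms by (simp add: powr_diff mult.assoc flip: mult.assoc ennreal_mult')
  have "ennreal (Gamma \<nu> / l powr \<nu>) = ennreal (1 / l powr \<nu>) * ennreal (Gamma \<nu>)"
    using assms by (simp flip: ennreal_mult')
  also have "\<dots> = (\<integral>\<^sup>+ u. ennreal (exp (- l * u) * u powr (\<nu> - 1)) * indicator {0<..} u \<partial>lborel)"
    unfolding eq using assms by (simp flip: mult.assoc ennreal_mult')
  finally show ?thesis by simp
qed

text \<open>For \<open>s \<le> T < t\<close> the kernel stays away from its singularity or zero at
  \<open>s = t\<close>, so its reciprocal is continuous and bounded and can be multiplied
  back.\<close>

lemma RL_integrable_imp_absolutely_integrable: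
  assumes "RL_integrable (of_real \<nu>) f t" "0 < T" "T < t"
  shows "f absolutely_integrable_on {0..T}"
proof -
  let ?K = "\<lambda>s. complex_of_real (t - s) powr (of_real \<nu> - 1)"
  have "(\<lambda>s. ?K s * f s) absolutely_integrable_on {0..T}"
    using assms unfolding RL_integrable_def by (elim set_integrable_subset) auto
  moreover have cont: "continuous_on {0..T} (\<lambda>s. complex_of_real (t - s) powr (1 - of_real \<nu>))"
    using assms by (intro continuous_intros) (auto simp: complex_nonpos_Reals_iff)
  hence "(\<lambda>s. complex_of_real (t - s) powr (1 - of_real \<nu>)) \<in> borel_measurable (lebesgue_on {0..T})"
    by (rule continuous_imp_measurable_on_sets_lebesgue) auto
  moreover have "bounded ((\<lambda>s. complex_of_real (t - s) powr (1 - of_real \<nu>)) ` {0..T})"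
    by (intro compact_imp_bounded compact_continuous_image cont) auto
  ultimately have "(\<lambda>s. complex_of_real (t - s) powr (1 - of_real \<nu>) * (?K s * f s))
                     absolutely_integrable_on {0..T}"
    by (intro absolutely_integrable_bounded_measurable_product[OF bilinear_times,
          where f = "\<lambda>s. complex_of_real (t - s) powr (1 - of_real \<nu>)"]) auto
  thus ?thesis
  proof (rule absolutely_integrable_spike[where S = "{}"])
    fix s assume "s \<in> {0..T} - {}"
    hence "complex_of_real (t - s) powr (1 - of_real \<nu>) * ?K s = 1"
      using assms by (subst powr_add [symmetric]) auto
    thus "f s = complex_of_real (t - s) powr (1 - of_real \<nu>) * (?K s * f s)"
      by (simp flip: mult.assoc)
  qed simp
qed

text \<open>The bound has convolution form over the whole line, a function of \<open>t - s\<close>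
  times one of \<open>s\<close>, as Tonelli's theorem and translation require.\<close>

lemma ennreal_norm_RL_integral_le:
  fixes c \<nu> :: real
  assumes "\<nu> > 0" "c > 0" "RL_integrable (of_real \<nu>) f t"
  shows "ennreal (norm (of_real c * RL_integral (of_real \<nu>) f t)) \<le>
    (\<integral>\<^sup>+ s. ennreal (c / Gamma \<nu> * (t - s) powr (\<nu> - 1)) * indicator {0<..} (t - s) *
             ennreal (indicator {0..t} s * norm (f s)) \<partial>lborel)"
proof -
  have G: "Gamma \<nu> > 0" using assms by (simp add: Gamma_real_pos)
  let ?g = "\<lambda>s. complex_of_real (t - s) powr (of_real \<nu> - 1) * f s"
  have int: "integrable lebesgue (\<lambda>s. indicator {0..t} s *\<^sub>R ?g s)"
    using assms(3) by (simp add: RL_integrable_def set_integrable_def)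
  have eq: "of_real c * RL_integral (of_real \<nu>) f t =
              of_real (c / Gamma \<nu>) * integral\<^sup>L lebesgue (\<lambda>s. indicator {0..t} s *\<^sub>R ?g s)"
    using set_lebesgue_integral_eq_integral(2)[of "{0..t}" ?g] assms(3)
    by (simp add: RL_integral_def RL_integrable_def set_lebesgue_integral_def Gamma_complex_of_real)
  have "ennreal (norm (of_real c * RL_integral (of_real \<nu>) f t)) =
        ennreal (c / Gamma \<nu>) * ennreal (norm (integral\<^sup>L lebesgue (\<lambda>s. indicator {0..t} s *\<^sub>R ?g s)))"
    unfolding eq norm_mult norm_of_real using G \<open>c > 0\<close>
    by (subst ennreal_mult [symmetric]) auto
  also have "\<dots> \<le> ennreal (c / Gamma \<nu>) *
      (\<integral>\<^sup>+ s. ennreal (norm (indicator {0..t} s *\<^sub>R ?g s)) \<partial>lebesgue)"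
    by (intro mult_left_mono integral_norm_bound_ennreal int) auto
  also have "\<dots> = (\<integral>\<^sup>+ s. ennreal (c / Gamma \<nu>) * ennreal (norm (indicator {0..t} s *\<^sub>R ?g s)) \<partial>lebesgue)"
    by (intro nn_integral_cmult [symmetric] measurable_compose[OF _ measurable_ennreal]
        borel_measurable_integrable integrable_norm int)
  \<comment> \<open>Passing from \<open>lebesgue\<close> to \<open>lborel\<close> preserves this
    integral for any integrand, Borel or not.\<close>
  also have "\<dots> = (\<integral>\<^sup>+ s. ennreal (c / Gamma \<nu>) * ennreal (norm (indicator {0..t} s *\<^sub>R ?g s)) \<partial>lborel)"
    by (rule nn_integral_completion)
  also have "\<dots> = (\<integral>\<^sup>+ s. ennreal (c / Gamma \<nu> * (t - s) powr (\<nu> - 1)) * indicator {0<..} (t - s) *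
             ennreal (indicator {0..t} s * norm (f s)) \<partial>lborel)"
  proof (intro nn_integral_cong)
    fix s :: real
    have "complex_of_real (t - s) powr (of_real \<nu> - 1) = of_real ((t - s) powr (\<nu> - 1))" if "s \<le> t"
      using that powr_of_real[of "t - s" "\<nu> - 1"] by simp
    thus "ennreal (c / Gamma \<nu>) * ennreal (norm (indicator {0..t} s *\<^sub>R ?g s)) =
          ennreal (c / Gamma \<nu> * (t - s) powr (\<nu> - 1)) * indicator {0<..} (t - s) *
             ennreal (indicator {0..t} s * norm (f s))"
      using G assms by (auto simp: indicator_def norm_mult mult.assoc simp flip: ennreal_mult' ennreal_mult'')
  qed
  finally show ?thesis .
qed

lemma homogeneous_RL_equation_zero:
  fixes W :: "real \<Rightarrow> complex" and c \<nu> T :: real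
  assumes "\<nu> > 0" "c > 0"
    and W: "W absolutely_integrable_on {0..T}"
    and RL: "\<And>t. t \<in> {0<..T} \<Longrightarrow> RL_integrable (of_real \<nu>) W t"
    and eq: "\<And>t. t \<in> {0<..T} \<Longrightarrow> W t = - of_real c * RL_integral (of_real \<nu>) W t"
    and t: "t \<in> {0<..T}"
  shows "W t = 0"
proof -
  \<comment> \<open>The cutoff at \<open>T\<close> gives an integrable function on the whole line,
    so translations meet no boundary.\<close>
  define w where "w = (\<lambda>s. indicator {0..T} s * norm (W s))"
  define k where "k = (\<lambda>u. ennreal (c / Gamma \<nu> * u powr (\<nu> - 1)) * indicator {0<..} u)"
  \<comment> \<open>Chosen so that \<open>l powr \<nu> = 2 * c\<close>; the contraction factor
    \<open>c / l powr \<nu>\<close> is then 1/2.\<close>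
  define l where "l = (2 * c) powr (1 / \<nu>)"
  define E where "E = (\<lambda>t. ennreal (exp (- l * t)))"
  have E_add: "E (s + u) = E s * E u" for s u
    by (simp add: E_def ring_distribs mult_exp_exp flip: ennreal_mult)
  have G: "Gamma \<nu> > 0" using assms by (simp add: Gamma_real_pos)
  have l: "l > 0" "l powr \<nu> = 2 * c"
    using assms by (auto simp: l_def powr_powr)
  have wint: "integrable lebesgue w"
    using integrable_norm[OF W[unfolded set_integrable_def]] by (simp add: w_def)
  \<comment> \<open>\<open>w\<close> is only Lebesgue measurable, but Tonelli's theorem for \<open>lborel\<close> needs a Borel function.\<close>
  then obtain g where g [measurable]: "g \<in> borel_measurable lborel"
    and wg: "AE s in lborel. w s = g s"
    using completion_ex_borel_measurable_real[of w lborel] by auto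
  have [measurable]: "k \<in> borel_measurable borel" "E \<in> borel_measurable borel"
    by (simp_all add: k_def E_def)
  define H where "H = (\<lambda>s. ennreal (g s))"
  have [measurable]: "H \<in> borel_measurable borel"
    using g unfolding H_def by simp
  have wH: "AE s in lborel. ennreal (w s) = H s"
    using wg by eventually_elim (simp add: H_def)
  have bound: "ennreal (w t) \<le> (\<integral>\<^sup>+ s. k (t - s) * H s \<partial>lborel)" if t: "t \<in> {0<..T}" for t
  proof -
    have "ennreal (w t) = ennreal (norm (of_real c * RL_integral (of_real \<nu>) W t))"
      using t by (simp add: w_def eq[OF t] norm_mult)
    also have "\<dots> \<le> (\<integral>\<^sup>+ s. k (t - s) * ennreal (indicator {0..t} s * norm (W s)) \<partial>lborel)"
      unfolding k_def using assms RL t by (intro ennreal_norm_RL_integral_le) auto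
    also have "\<dots> \<le> (\<integral>\<^sup>+ s. k (t - s) * ennreal (w s) \<partial>lborel)"
      using t by (intro nn_integral_mono mult_left_mono ennreal_leI) (auto simp: w_def indicator_def)
    also have "\<dots> = (\<integral>\<^sup>+ s. k (t - s) * H s \<partial>lborel)"
      using wH by (intro nn_integral_cong_AE) (auto elim!: eventually_mono)
    finally show ?thesis .
  qed
  define X where "X = (\<integral>\<^sup>+ t. E t * H t \<partial>lborel)"
  have Q: "(\<integral>\<^sup>+ u. E u * k u \<partial>lborel) = ennreal (1 / 2)"
  proof -
    have "(\<integral>\<^sup>+ u. E u * k u \<partial>lborel) = (\<integral>\<^sup>+ u. ennreal (c / Gamma \<nu>) *
            (ennreal (exp (- l * u) * u powr (\<nu> - 1)) * indicator {0<..} u) \<partial>lborel)"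
      using G assms by (intro nn_integral_cong)
        (auto simp: E_def k_def indicator_def simp flip: ennreal_mult' ennreal_mult'')
    also have "\<dots> = ennreal (c / Gamma \<nu>) * ennreal (Gamma \<nu> / l powr \<nu>)"
      using assms l by (subst nn_integral_cmult) (auto simp: nn_integral_Laplace_powr[simplified])
    also have "\<dots> = ennreal (1 / 2)"
      using G less_imp_neq[OF G] \<open>c > 0\<close> l by (subst ennreal_mult [symmetric]) auto
    finally show ?thesis .
  qed
  have "X \<le> (\<integral>\<^sup>+ t. E t * (\<integral>\<^sup>+ s. k (t - s) * H s \<partial>lborel) \<partial>lborel)"
    unfolding X_def
  proof (rule nn_integral_mono_AE)
    \<comment> \<open>Outside \<open>{0<..T}\<close> the cutoff makes \<open>w\<close> vanish,
      except possibly at 0, where no equation is assumed; that point is a null set.\<close>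
    show "AE t in lborel. E t * H t \<le> E t * (\<integral>\<^sup>+ s. k (t - s) * H s \<partial>lborel)"
      using wH AE_lborel_singleton[of 0]
    proof eventually_elim
      case (elim t)
      show ?case
      proof (cases "t \<in> {0<..T}")
        case True
        thus ?thesis using bound[of t] elim by (intro mult_left_mono) auto
      next
        case False
        hence "w t = 0" using elim by (auto simp: w_def indicator_def)
        thus ?thesis using elim by (metis ennreal_0 mult_zero_right zero_le)
      qed
    qed
  qed
  also have "\<dots> = (\<integral>\<^sup>+ t. (\<integral>\<^sup>+ s. E t * (k (t - s) * H s) \<partial>lborel) \<partial>lborel)"
    by (intro nn_integral_cong nn_integral_cmult [symmetric]) simp
  also have "\<dots> = (\<integral>\<^sup>+ s. (\<integral>\<^sup>+ t. E t * (k (t - s) * H s) \<partial>lborel) \<partial>lborel)"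
    by (rule lborel_pair.Fubini') simp
  also have "\<dots> = (\<integral>\<^sup>+ s. ennreal (1 / 2) * (E s * H s) \<partial>lborel)"
  proof (rule nn_integral_cong)
    fix s :: real
    \<comment> \<open>After the translation \<open>t = s + u\<close> the exponential weight factors
      by \<open>E_add\<close>, leaving the Laplace integral \<open>Q\<close>.\<close>
    have "(\<integral>\<^sup>+ t. E t * (k (t - s) * H s) \<partial>lborel) = (\<integral>\<^sup>+ u. E (s + u) * (k u * H s) \<partial>lborel)"
      using nn_integral_real_affine[of "\<lambda>t. E t * (k (t - s) * H s)" 1 s] by simp
    also have "\<dots> = (\<integral>\<^sup>+ u. (E s * H s) * (E u * k u) \<partial>lborel)"
      by (intro nn_integral_cong) (simp add: E_add mult_ac)
    also have "\<dots> = (E s * H s) * ennreal (1 / 2)"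
      by (subst nn_integral_cmult) (simp_all add: Q)
    finally show "(\<integral>\<^sup>+ t. E t * (k (t - s) * H s) \<partial>lborel) = ennreal (1 / 2) * (E s * H s)"
      by (simp add: mult_ac)
  qed
  also have "\<dots> = ennreal (1 / 2) * X"
    unfolding X_def by (rule nn_integral_cmult) simp
  finally have X_le: "X \<le> ennreal (1 / 2) * X" .
  \<comment> \<open>\<open>X_le\<close> also holds for an infinite \<open>X\<close>, so finiteness
    has to come first. The weight exceeds 1 at negative times, but \<open>w\<close> is 0
    there.\<close>
  have "X \<le> (\<integral>\<^sup>+ t. H t \<partial>lborel)"
    unfolding X_def
  proof (rule nn_integral_mono_AE)
    show "AE t in lborel. E t * H t \<le> H t"
      using wH
    proof eventually_elim
      case (elim t)
      show ?case
      proof (cases "t \<ge> 0")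
        case True
        hence "E t \<le> 1" using l by (simp add: E_def)
        thus ?thesis using mult_right_mono[of "E t" 1 "H t"] by simp
      next
        case False
        hence "w t = 0" by (auto simp: w_def)
        thus ?thesis using elim by (metis ennreal_0 mult_zero_right zero_le)
      qed
    qed
  qed
  also have "\<dots> = (\<integral>\<^sup>+ t. ennreal (w t) \<partial>lborel)"
    using wH by (intro nn_integral_cong_AE) (auto elim!: eventually_mono)
  also have "\<dots> = (\<integral>\<^sup>+ t. ennreal (norm (w t)) \<partial>lebesgue)"
    by (simp add: nn_integral_completion w_def)
  also have "\<dots> < \<infinity>"
    using wint by (simp add: integrable_iff_bounded)
  finally obtain x where x: "X = ennreal x" "x \<ge> 0"
    by (cases X) auto
  have "X = 0"
    using X_le x unfolding x(1) by (subst (asm) ennreal_mult [symmetric]) (auto simp: ennreal_le_iff2)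
  hence "AE t in lborel. E t * H t = 0"
    unfolding X_def by (subst (asm) nn_integral_0_iff_AE) auto
  hence "AE t in lborel. H t = 0"
    by eventually_elim (auto simp: E_def)
  \<comment> \<open>The integral in \<open>bound\<close> ignores null sets while its left side is
    pointwise: this turns almost everywhere into everywhere.\<close>
  hence "(\<integral>\<^sup>+ s. k (t - s) * H s \<partial>lborel) = (\<integral>\<^sup>+ s. 0 \<partial>(lborel :: real measure))"
    by (intro nn_integral_cong_AE) (auto elim!: eventually_mono)
  hence "w t = 0"
    using bound[OF t] by (simp add: w_def)
  thus ?thesis using t by (simp add: w_def)
qed

subsection \<open>The kinetic equation\<close>

lemma RL_integrable_cmult:
  assumes "RL_integrable \<mu> f t"
  shows "RL_integrable \<mu> (\<lambda>s. c * f s) t"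
    and "RL_integral \<mu> (\<lambda>s. c * f s) t = c * RL_integral \<mu> f t"
proof -
  let ?f = "\<lambda>s. of_real (t - s) powr (\<mu> - 1) * f s"
  have "(\<lambda>s. c * ?f s) absolutely_integrable_on {0..t}"
    using assms unfolding RL_integrable_def by (intro set_integrable_mult_right)
  moreover have "integral {0..t} (\<lambda>s. c * ?f s) = c * integral {0..t} ?f"
    by (rule integral_mult_right)
  ultimately show "RL_integrable \<mu> (\<lambda>s. c * f s) t"
    "RL_integral \<mu> (\<lambda>s. c * f s) t = c * RL_integral \<mu> f t"
    by (simp_all add: RL_integrable_def RL_integral_def mult_ac)
qed

lemma RL_integrable_diff:
  assumes "RL_integrable \<mu> f t" "RL_integrable \<mu> g t"
  shows "RL_integrable \<mu> (\<lambda>s. f s - g s) t"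
    and "RL_integral \<mu> (\<lambda>s. f s - g s) t = RL_integral \<mu> f t - RL_integral \<mu> g t"
  using set_integral_diff(1)[OF assms[unfolded RL_integrable_def]]
    integral_diff[OF assms[unfolded RL_integrable_def, THEN set_lebesgue_integral_eq_integral(1)]]
  by (simp_all add: RL_integrable_def RL_integral_def ring_distribs)

text \<open>The endpoints form a null set. Dropping 0 matters because a solution is only constrained
  at positive times.\<close>

lemma RL_cong:
  assumes "\<And>s. s \<in> {0<..<t} \<Longrightarrow> f s = g s"
  shows "RL_integrable \<mu> f t \<longleftrightarrow> RL_integrable \<mu> g t"
    and "RL_integral \<mu> f t = RL_integral \<mu> g t"
proof -
  have eq: "of_real (t - s) powr (\<mu> - 1) * g s = of_real (t - s) powr (\<mu> - 1) * f s"
    if "s \<in> {0..t} - {0, t}" for s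
    using assms[of s] that by auto
  show "RL_integrable \<mu> f t \<longleftrightarrow> RL_integrable \<mu> g t"
    unfolding RL_integrable_def using eq by (intro absolutely_integrable_spike_eq[of "{0, t}"]) auto
  show "RL_integral \<mu> f t = RL_integral \<mu> g t"
    using integral_spike[of "{0, t}" "{0..t}", OF _ eq] by (simp add: RL_integral_def)
qed

lemma kinetic_solution_unique:
  fixes r :: ereal
  assumes "d > 0" "\<nu> > 0"
    and M: "kinetic_solution_on {t. 0 < t \<and> ereal t < r} d \<nu> N0 f M"
    and N: "kinetic_solution_on {t. 0 < t \<and> ereal t < r} d \<nu> N0 f N"
    and t: "0 < t" "ereal t < r"
  shows "M t = N t"
proof -
  \<comment> \<open>The set of times is open on the right. Integrability of the difference on
    \<open>{0..t}\<close> is read off from its fractional integral at the later time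
    \<open>t'\<close>.\<close>
  obtain t' where t': "t < t'" "ereal t' < r"
    using t(2) ereal_dense2[of "ereal t" r] by auto
  have sol: "RL_integrable (of_real \<nu>) (\<lambda>s. M s - N s) u \<and>
      M u - N u = - of_real (d powr \<nu>) * RL_integral (of_real \<nu>) (\<lambda>s. M s - N s) u"
    if u: "0 < u" "ereal u < r" for u
  proof -
    have M': "RL_integrable (of_real \<nu>) M u"
      "M u - N0 * f u = - of_real (d powr \<nu>) * RL_integral (of_real \<nu>) M u"
      and N': "RL_integrable (of_real \<nu>) N u"
      "N u - N0 * f u = - of_real (d powr \<nu>) * RL_integral (of_real \<nu>) N u"
      using M N u by (auto simp: kinetic_solution_on_def)
    have "M u - N u = (M u - N0 * f u) - (N u - N0 * f u)" by simp
    also have "\<dots> = - of_real (d powr \<nu>) * RL_integral (of_real \<nu>) (\<lambda>s. M s - N s) u"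
      unfolding M'(2) N'(2) RL_integrable_diff(2)[OF M'(1) N'(1)] by (simp add: algebra_simps)
    finally show ?thesis using RL_integrable_diff(1)[OF M'(1) N'(1)] by blast
  qed
  have "(\<lambda>s. M s - N s) absolutely_integrable_on {0..t}"
    using sol[of t'] t t' by (intro RL_integrable_imp_absolutely_integrable[where \<nu> = \<nu> and t = t']) auto
  moreover have "ereal u < r" if "u \<le> t" for u
    using that t(2) by (metis ereal_less_eq(3) order_le_less_trans)
  ultimately have "(\<lambda>s. M s - N s) t = 0"
    using assms sol by (intro homogeneous_RL_equation_zero[where \<nu> = \<nu> and c = "d powr \<nu>" and T = t]) auto
  thus ?thesis by simp
qed

lemma kinetic_solution_on_iff_series:
  fixes a :: "nat \<Rightarrow> complex"
  assumes "d > 0" "\<nu> > 0"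
  defines "T \<equiv> {t. 0 < t \<and> ereal t < conv_radius (\<lambda>n. a n / fact n)}"
  shows "t \<in> T \<Longrightarrow> summable (\<lambda>n. a n * of_real t ^ n *
           Mittag_Leffler (of_real \<nu>) (of_nat n + 1) (- of_real (d powr \<nu> * t powr \<nu>)))"
    and "kinetic_solution_on T d \<nu> N0 (\<lambda>t. \<Sum>n. a n * of_real t ^ n / fact n) N \<longleftrightarrow>
           (\<forall>t\<in>T. N t = N0 * kinetic_series a \<nu> (d powr \<nu>) t)"
proof -
  have d: "d powr \<nu> > 0" using assms by simp
  \<comment> \<open>Strictly inside the disc a power series converges absolutely.\<close>
  have summ: "summable (\<lambda>n. norm (a n) * t ^ n / fact n)" if "t \<in> T" for t
    using abs_summable_in_conv_radius[of "complex_of_real t" "\<lambda>n. a n / fact n"] that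
    by (simp add: T_def norm_mult norm_divide norm_power)
  show "summable (\<lambda>n. a n * of_real t ^ n *
           Mittag_Leffler (of_real \<nu>) (of_nat n + 1) (- of_real (d powr \<nu> * t powr \<nu>)))"
    if "t \<in> T"
    using summable_norm_cancel[OF summable_kinetic_series_norm[OF \<open>\<nu> > 0\<close> d _ summ[OF that], of t]] that
    by (simp add: T_def)
  let ?S = "\<lambda>t. N0 * kinetic_series a \<nu> (d powr \<nu>) t" and ?f = "\<lambda>t. \<Sum>n. a n * of_real t ^ n / fact n"
  have S: "RL_integrable (of_real \<nu>) ?S t \<and>
             ?S t - N0 * ?f t = - of_real (d powr \<nu>) * RL_integral (of_real \<nu>) ?S t" if "t \<in> T" for t
  proof -
    have "t > 0" using that by (simp add: T_def)
    note RL = RL_kinetic_series[OF \<open>\<nu> > 0\<close> d this summ[OF that]]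
    show ?thesis
      using RL_integrable_cmult[OF RL(1), of N0] RL(2) assms(1) by (simp add: field_simps)
  qed
  show "kinetic_solution_on T d \<nu> N0 ?f N \<longleftrightarrow> (\<forall>t\<in>T. N t = ?S t)"
  proof
    assume "kinetic_solution_on T d \<nu> N0 ?f N"
    moreover have "kinetic_solution_on T d \<nu> N0 ?f ?S"
      using S by (simp add: kinetic_solution_on_def)
    ultimately show "\<forall>t\<in>T. N t = ?S t"
      using assms(1,2) unfolding T_def by (intro ballI kinetic_solution_unique) auto
  next
    assume N: "\<forall>t\<in>T. N t = ?S t"
    show "kinetic_solution_on T d \<nu> N0 ?f N"
      unfolding kinetic_solution_on_def
    proof
      fix t assume t: "t \<in> T"
      \<comment> \<open>The fractional integral at \<open>t\<close> only sees times in
        \<open>{0<..<t}\<close>, and these lie in \<open>T\<close>, where \<open>N\<close> is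
        known.\<close>
      have "s \<in> T" if "s \<in> {0<..<t}" for s
        using t that unfolding T_def by (auto intro: less_trans[of "ereal s" "ereal t"])
      hence "?S s = N s" if "s \<in> {0<..<t}" for s
        using N that by simp
      note RL = RL_cong[of t ?S N, OF this]
      show "RL_integrable (of_real \<nu>) N t \<and>
              N t - N0 * ?f t = - of_real (d powr \<nu>) * RL_integral (of_real \<nu>) N t"
        using S[OF t] N t RL by simp
    qed
  qed
qed

theorem theorem1:
  fixes d \<nu> k \<tau> :: real and \<alpha> \<beta> \<gamma> N0 :: complex
  assumes "d > 0" and "\<nu> > 0"
    and "Re \<alpha> > 0" and "Re \<beta> > 0" and "Re \<gamma> > 0"
    and "\<tau> \<in> {0<..<1} \<union> \<nat>"
  shows "(\<forall>t \<in> k_Mittag_Leffler_times k \<alpha> \<beta> \<gamma> \<tau>.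
            summable (\<lambda>n. k_pochhammer k \<gamma> (real n * \<tau>) / k_Gamma k (of_nat n * \<alpha> + \<beta>)
              * of_real t ^ n
              * Mittag_Leffler (of_real \<nu>) (of_nat n + 1) (- of_real (d powr \<nu> * t powr \<nu>))))
    \<and> (\<forall>N :: real \<Rightarrow> complex.
         kinetic_solution_on (k_Mittag_Leffler_times k \<alpha> \<beta> \<gamma> \<tau>) d \<nu> N0
           (\<lambda>t. k_Mittag_Leffler k \<alpha> \<beta> \<gamma> \<tau> (of_real t)) N
         \<longleftrightarrow>
         (\<forall>t \<in> k_Mittag_Leffler_times k \<alpha> \<beta> \<gamma> \<tau>.
            N t = N0 * (\<Sum>n. k_pochhammer k \<gamma> (real n * \<tau>) / k_Gamma k (of_nat n * \<alpha> + \<beta>)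
              * of_real t ^ n
              * Mittag_Leffler (of_real \<nu>) (of_nat n + 1) (- of_real (d powr \<nu> * t powr \<nu>)))))"
proof -
  define a where "a = (\<lambda>n. k_pochhammer k \<gamma> (real n * \<tau>) / k_Gamma k (of_nat n * \<alpha> + \<beta>))"
  have times: "k_Mittag_Leffler_times k \<alpha> \<beta> \<gamma> \<tau> =
      {t. 0 < t \<and> ereal t < conv_radius (\<lambda>n. a n / fact n)}"
    by (simp add: k_Mittag_Leffler_times_def a_def)
  \<comment> \<open>The regrouping survives a vanishing \<open>k_Gamma\<close>: division by 0 makes
    the term 0 on both sides.\<close>
  have series: "(\<lambda>t. k_Mittag_Leffler k \<alpha> \<beta> \<gamma> \<tau> (of_real t)) =
      (\<lambda>t. \<Sum>n. a n * of_real t ^ n / fact n)"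
    by (simp add: k_Mittag_Leffler_def a_def)
  show ?thesis
    using kinetic_solution_on_iff_series[OF assms(1,2), where a = a]
    unfolding times series kinetic_series_def a_def by blast
qed

end
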